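(* Let $H \in \mathbb{R}^{n\times n}$ be symmetric positive definite, let $c \in \mathbb{R}^n$, and let $q(x) = \frac12 x^T H x + c^T x$. Given $x_0\in\mathbb{R}^n$, let $x_k$, $k=1,2,\dots$, be the minimizer of $q(x)$ subject to $x\in x_0+\operatorname{span}(\{g_0,\dots,g_{k-1}\})$, where $g_i=\nabla q(x_i)$, and let $r$ be the smallest nonnegative integer with $g_r=0$. Let $0\le k<r$ and let $\hat g_k$ be the vector of minimum Euclidean norm in the affine span of $g_0,g_1,\dots,g_k$. Then $\hat g_k\ne 0$, $$\hat g_k = \frac{1}{\sum_{j=0}^k \frac{1}{g_j^Tg_j}}\sum_{i=0}^k \frac{1}{g_i^Tg_i}\,g_i,$$ and $\hat g_k$ is equivalently the vector of minimum Euclidean norm among all gradients $\nabla q(x)$ with $x$ in the affine span of $x_0,x_1,\dots,x_k$, which equals $x_0+\operatorname{span}(\{g_0,\dots,g_{k-1}\})$. Moreover, the search direction $p_k^{CG}$ of the method of conjugate gradients satisfies $$p_k^{CG} = -\frac{g_k^Tg_k}{\hat g_k^T\hat g_k}\,\hat g_k .$$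
   Context: The minimizers $x_k$ exist and are unique, and an index $r\le n$ with $g_r=0$ exists. The conjugate gradient search directions are defined, for $0\le k<r$, by the recursion $$p_0^{CG} = -g_0,\qquad p_k^{CG} = -g_k + \frac{g_k^Tg_k}{g_{k-1}^Tg_{k-1}}\,p_{k-1}^{CG}\quad (1\le k<r).$$ The affine span of vectors $v_0,\dots,v_k$ is the set $\{\sum_{i=0}^k\alpha_i v_i : \alpha_i\in\mathbb{R},\ \sum_{i=0}^k\alpha_i=1\}$; $\operatorname{span}$ denotes the linear span (with $\operatorname{span}(\emptyset)=\{0\}$); and $\nabla q(x)=Hx+c$. *)

theory Defs
  imports "HOL-Analysis.Analysis"
begin

definition quad :: "real^'n^'n \<Rightarrow> real^'n \<Rightarrow> real^'n \<Rightarrow> real" where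
  "quad H c x = 1/2 * (x \<bullet> (H *v x)) + c \<bullet> x"

definition quad_grad :: "real^'n^'n \<Rightarrow> real^'n \<Rightarrow> real^'n \<Rightarrow> real^'n" where
  "quad_grad H c x = H *v x + c"

lemma GDERIV_quad:
  fixes H :: "real^'n^'n"
  assumes "transpose H = H"
  shows "GDERIV (quad H c) x :> quad_grad H c x"
proof -
  have eq: "x \<bullet> (H *v h) = h \<bullet> (H *v x)" for h
    by (metis assms dot_lmul_matrix inner_commute transpose_matrix_vector)
  have "(quad H c has_derivative
      (\<lambda>h. 1/2 * (x \<bullet> (H *v h) + h \<bullet> (H *v x)) + c \<bullet> h)) (at x)"
    unfolding quad_def[abs_def]
    by (auto intro!: derivative_eq_intros
          bounded_linear.has_derivative[OF matrix_vector_mul_bounded_linear])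
  then show ?thesis
    unfolding gderiv_def quad_grad_def
    by (simp add: eq inner_add_right inner_commute[of c])
qed

definition is_the_minimizer :: "('a \<Rightarrow> real) \<Rightarrow> 'a set \<Rightarrow> 'a \<Rightarrow> bool" where
  "is_the_minimizer f S v \<longleftrightarrow> (\<forall>w. is_arg_min f (\<lambda>y. y \<in> S) w \<longleftrightarrow> w = v)"

primrec cg_direction :: "(nat \<Rightarrow> real^'n) \<Rightarrow> nat \<Rightarrow> real^'n" where
  "cg_direction g 0 = - g 0"
| "cg_direction g (Suc k) =
     - g (Suc k) + ((g (Suc k) \<bullet> g (Suc k)) / (g k \<bullet> g k)) *\<^sub>R cg_direction g k"

end

theory Submission
  imports Defs
begin

text \<open>
  Minimality of \<open>x i\<close> over \<open>x0 + span {g 0, \<dots>, g (i - 1)}\<close> makes \<open>g i\<close> orthogonal to all earlier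
  gradients (\<open>quad_grad_orthogonal_at_minimizer\<close>), so \<open>g 0, \<dots>, g k\<close> are nonzero and pairwise orthogonal.

  The vector \<open>h = (1 / s) (\<Sum>i\<le>k. g i / |g i|\<^sup>2)\<close> with \<open>s = (\<Sum>i\<le>k. 1 / |g i|\<^sup>2)\<close> has the same inner product
  \<open>1 / s\<close> with every \<open>g i\<close>, hence with every point of their affine hull, to which it also belongs.
  By Pythagoras it is the unique point of least norm there, and \<open>h \<bullet> h = 1 / s\<close>
  (\<open>reciprocal_combination_inner\<close>, \<open>is_the_minimizer_norm_if_inner_const\<close>).

  The gradient is an affine map, so it sends the affine hull of the iterates onto that of the
  gradients, which has dimension \<open>k\<close> by orthogonality. The affine hull of the iterates
  therefore has dimension at least \<open>k\<close>; as it lies in the \<open>k\<close>-dimensional space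
  \<open>x0 + span {g 0, \<dots>, g (k - 1)}\<close>, the two coincide.

  Finally, dividing the conjugate gradient recursion by \<open>|g k|\<^sup>2\<close> makes it telescope to
  \<open>p k / |g k|\<^sup>2 = - (\<Sum>i\<le>k. g i / |g i|\<^sup>2) = - s h\<close> (\<open>cg_direction_closed_form\<close>), and \<open>s = 1 / (h \<bullet> h)\<close>.
\<close>

lemma quad_add:
  fixes H :: "real^'n^'n"
  assumes "transpose H = H"
  shows "quad H c (x + d) = quad H c x + quad_grad H c x \<bullet> d + 1/2 * (d \<bullet> (H *v d))"
proof -
  have "x \<bullet> (H *v d) = d \<bullet> (H *v x)"
    by (metis assms dot_lmul_matrix inner_commute transpose_matrix_vector)
  then show ?thesis
    by (simp add: quad_def quad_grad_def matrix_vector_right_distrib algebra_simps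
        inner_commute[of "H *v x" d])
qed

text \<open>A nonzero slope \<open>b\<close> along \<open>d\<close> would dominate the quadratic term for short steps against it.\<close>
lemma quad_grad_orthogonal_at_minimizer:
  fixes H :: "real^'n^'n"
  assumes sym: "transpose H = H"
    and min: "is_arg_min (quad H c) (\<lambda>y. y \<in> (+) a ` span S) x"
    and d: "d \<in> span S"
  shows "quad_grad H c x \<bullet> d = 0"
proof (rule ccontr)
  define b A where "b = quad_grad H c x \<bullet> d" and "A = d \<bullet> (H *v d)"
  assume "quad_grad H c x \<bullet> d \<noteq> 0"
  then have b: "b \<noteq> 0" by (simp add: b_def)
  \<comment> \<open>The step \<open>t\<close> below minimizes \<open>t * b + t\<^sup>2 * m / 2\<close>, where \<open>m\<close> is a positive upper bound for the curvature.\<close>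
  define m where "m = \<bar>A\<bar> + 1"
  have m: "m > 0" "A \<le> m" by (auto simp: m_def)
  define t where "t = - b / m"
  obtain s where s: "s \<in> span S" "x = a + s"
    using min by (auto simp: is_arg_min_def)
  have "x + t *\<^sub>R d \<in> (+) a ` span S"
    unfolding s(2) add.assoc using s(1) d by (intro imageI span_add span_mul)
  then have "quad H c x \<le> quad H c (x + t *\<^sub>R d)"
    using min unfolding is_arg_min_def not_less[symmetric] by blast
  also have "\<dots> = quad H c x + (t * b + 1/2 * (t\<^sup>2 * A))"
    unfolding quad_add[OF sym]
    by (simp add: b_def A_def matrix_vector_mult_scaleR power2_eq_square)
  finally have "0 \<le> t * b + 1/2 * (t\<^sup>2 * A)" by simp
  also have "\<dots> \<le> t * b + 1/2 * (t\<^sup>2 * m)"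
    using m by (simp add: mult_left_mono)
  also have "\<dots> = - (b\<^sup>2 / (2 * m))"
    using m by (simp add: t_def field_simps power2_eq_square)
  also have "\<dots> < 0"
    using b m by simp
  finally show False by simp
qed

lemma is_the_minimizer_unique:
  assumes "is_the_minimizer f S v"
  shows "arg_min_on f S = v"
proof -
  have "is_arg_min f (\<lambda>y. y \<in> S) = (\<lambda>w. w = v)"
    using assms by (auto simp: is_the_minimizer_def)
  then show ?thesis by (simp add: arg_min_on_def arg_min_def)
qed

text \<open>The hypothesis says that \<open>y - v\<close> is orthogonal to \<open>v\<close> for all \<open>y\<close> in \<open>S\<close>, so Pythagoras applies.\<close>
lemma is_the_minimizer_norm_if_inner_const:
  fixes v :: "'a::real_inner"
  assumes v: "v \<in> S" and inner: "\<And>y. y \<in> S \<Longrightarrow> v \<bullet> y = v \<bullet> v"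
  shows "is_the_minimizer norm S v"
proof -
  have less: "norm v < norm y" if "y \<in> S" "y \<noteq> v" for y
  proof -
    have "y \<bullet> y = v \<bullet> v + (y - v) \<bullet> (y - v)"
      using inner[OF that(1)] by (simp add: inner_diff inner_commute)
    then have "v \<bullet> v < y \<bullet> y" using that(2) by simp
    then show ?thesis by (simp add: norm_lt)
  qed
  then show ?thesis
    unfolding is_the_minimizer_def is_arg_min_def
    by (metis v less_asym)
qed

lemma inner_const_on_affine_hull:
  fixes v :: "'a::real_inner"
  assumes "\<And>s. s \<in> S \<Longrightarrow> v \<bullet> s = e" and "y \<in> affine hull S"
  shows "v \<bullet> y = e"
proof -
  have "affine hull S \<subseteq> {y. v \<bullet> y = e}"
    using assms(1) by (intro hull_minimal affine_hyperplane) auto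
  with assms(2) show ?thesis by auto
qed

text \<open>Weighting orthogonal vectors by the reciprocals of their squared norms equalizes the inner
  products with them.\<close>
lemma reciprocal_combination_inner:
  fixes g :: "'i \<Rightarrow> 'a::real_inner"
  assumes "finite I" and ne: "\<And>i. i \<in> I \<Longrightarrow> g i \<noteq> 0"
    and orth: "\<And>i j. i \<in> I \<Longrightarrow> j \<in> I \<Longrightarrow> i \<noteq> j \<Longrightarrow> g i \<bullet> g j = 0"
    and j: "j \<in> I"
  shows "(\<Sum>i\<in>I. (1 / (g i \<bullet> g i)) *\<^sub>R g i) \<bullet> g j = 1"
proof -
  have "(\<Sum>i\<in>I. (1 / (g i \<bullet> g i)) *\<^sub>R g i) \<bullet> g j = (\<Sum>i\<in>I. if i = j then 1 else 0)"
    unfolding inner_sum_left by (rule sum.cong) (use ne orth j in auto)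
  then show ?thesis using assms(1) j by simp
qed

lemma weighted_mean_in_affine_hull:
  fixes g :: "'i \<Rightarrow> 'a::real_vector"
  assumes "finite I" and "\<And>i. i \<in> I \<Longrightarrow> w i \<ge> 0" and "sum w I > 0"
  shows "(1 / sum w I) *\<^sub>R (\<Sum>i\<in>I. w i *\<^sub>R g i) \<in> affine hull (g ` I)"
proof -
  have "(\<Sum>i\<in>I. (w i / sum w I) *\<^sub>R g i) \<in> affine hull (g ` I)"
    using assms
    by (intro convex_sum affine_imp_convex affine_affine_hull)
      (auto simp: sum_divide_distrib[symmetric] hull_inc)
  then show ?thesis by (simp add: scaleR_sum_right)
qed

lemma quad_grad_affine_hull:
  "quad_grad H c ` (affine hull S) = affine hull (quad_grad H c ` S)"
proof -
  have eq: "quad_grad H c ` T = (+) c ` ((*v) H) ` T" for T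
    by (auto simp: quad_grad_def image_iff add.commute)
  show ?thesis
    unfolding eq by (simp add: affine_hull_translation affine_hull_linear_image)
qed

lemma aff_dim_quad_grad_image_le: "aff_dim (quad_grad H c ` S) \<le> aff_dim S"
proof -
  have "quad_grad H c ` S = (+) c ` ((*v) H) ` S"
    by (auto simp: quad_grad_def image_iff add.commute)
  then show ?thesis
    by (simp add: aff_dim_translation_eq aff_dim_linear_image_le)
qed

lemma aff_dim_orthogonal_family:
  fixes g :: "'i \<Rightarrow> 'a::euclidean_space"
  assumes "finite I" and ne: "\<And>i. i \<in> I \<Longrightarrow> g i \<noteq> 0"
    and orth: "\<And>i j. i \<in> I \<Longrightarrow> j \<in> I \<Longrightarrow> i \<noteq> j \<Longrightarrow> g i \<bullet> g j = 0"
  shows "aff_dim (g ` I) = int (card I) - 1"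
proof -
  have inj: "inj_on g I"
    by (rule inj_onI) (metis inner_eq_zero_iff ne orth)
  have "pairwise orthogonal (g ` I)"
    unfolding pairwise_def orthogonal_def using orth by auto
  then have "independent (g ` I)"
    using ne by (intro pairwise_orthogonal_independent) auto
  then have "\<not> affine_dependent (g ` I)"
    using affine_dependent_imp_dependent by blast
  then show ?thesis
    using aff_dim_affine_independent[of "g ` I"] by (simp add: card_image[OF inj])
qed

lemma cg_direction_closed_form:
  assumes "\<And>i. i \<le> k \<Longrightarrow> g i \<noteq> 0"
  shows "cg_direction g k = - (g k \<bullet> g k) *\<^sub>R (\<Sum>i\<le>k. (1 / (g i \<bullet> g i)) *\<^sub>R g i)"
  using assms
proof (induction k)
  case 0
  then show ?case by simp
next
  case (Suc k)
  have "g k \<noteq> 0" "g (Suc k) \<noteq> 0" using Suc.prems by auto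
  then show ?case
    using Suc by (simp add: algebra_simps)
qed


theorem mainTheorem3:
  fixes H :: "real^'n^'n" and c x0 ghat :: "real^'n"
    and x g :: "nat \<Rightarrow> real^'n" and r k :: nat
  assumes symmetric: "transpose H = H"
    and positive_definite: "\<forall>v. v \<noteq> 0 \<longrightarrow> v \<bullet> (H *v v) > 0"
    and gradients: "\<forall>i. g i = quad_grad H c (x i)"
    and initial: "x 0 = x0"
    and iterates: "\<forall>i\<ge>1. is_arg_min (quad H c)
                     (\<lambda>y. y \<in> (+) x0 ` span (g ` {..<i})) (x i)"
    and r: "r = (LEAST j. g j = 0)"
    and k: "k < r"
    and ghat: "ghat = arg_min_on norm (affine hull (g ` {..k}))"
  shows "is_the_minimizer norm (affine hull (g ` {..k})) ghat
    \<and> ghat \<noteq> 0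
    \<and> ghat = (1 / (\<Sum>j\<le>k. 1 / (g j \<bullet> g j))) *\<^sub>R (\<Sum>i\<le>k. (1 / (g i \<bullet> g i)) *\<^sub>R g i)
    \<and> affine hull (x ` {..k}) = (+) x0 ` span (g ` {..<k})
    \<and> is_the_minimizer norm (quad_grad H c ` (affine hull (x ` {..k}))) ghat
    \<and> cg_direction g k = - ((g k \<bullet> g k) / (ghat \<bullet> ghat)) *\<^sub>R ghat"
proof -
  define w where "w = (\<lambda>i. 1 / (g i \<bullet> g i))"
  define u where "u = (\<Sum>i\<le>k. w i *\<^sub>R g i)"
  define h where "h = (1 / sum w {..k}) *\<^sub>R u"
  have g_eq: "g = quad_grad H c \<circ> x"
    using gradients by auto

  have ne: "g i \<noteq> 0" if "i \<le> k" for i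
    using that k not_less_Least[of i "\<lambda>j. g j = 0"] r by auto
  have orth_less: "g i \<bullet> g j = 0" if "j < i" for i j
    using quad_grad_orthogonal_at_minimizer[OF symmetric, of c x0 "g ` {..<i}" "x i" "g j"]
      iterates that gradients by (auto intro: span_base)
  have orth: "g i \<bullet> g j = 0" if "i \<noteq> j" for i j
    using that orth_less[of i j] orth_less[of j i] by (metis inner_commute nat_neq_iff)

  have s_pos: "sum w {..k} > 0"
    by (rule sum_pos) (use ne in \<open>auto simp: w_def\<close>)
  have h_in: "h \<in> affine hull (g ` {..k})"
    unfolding h_def u_def using s_pos by (intro weighted_mean_in_affine_hull) (auto simp: w_def)
  have "u \<bullet> g j = 1" if "j \<le> k" for j
    unfolding u_def w_def using that ne orth by (intro reciprocal_combination_inner) auto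
  then have "h \<bullet> g j = 1 / sum w {..k}" if "j \<le> k" for j
    using that by (simp add: h_def)
  then have h_inner: "h \<bullet> y = 1 / sum w {..k}" if "y \<in> affine hull (g ` {..k})" for y
    using inner_const_on_affine_hull[OF _ that, of h] by auto
  have hh: "h \<bullet> h = 1 / sum w {..k}"
    using h_inner h_in .
  have minh: "is_the_minimizer norm (affine hull (g ` {..k})) h"
    by (rule is_the_minimizer_norm_if_inner_const) (use h_in h_inner hh in auto)
  have ghat_h: "ghat = h"
    using is_the_minimizer_unique[OF minh] ghat by simp

  have hull_x: "affine hull (x ` {..k}) = (+) x0 ` span (g ` {..<k})" (is "?A = ?B")
  proof (rule affine_dim_equal)
    show "affine ?B"
      by (simp add: affine_translation[symmetric] subspace_imp_affine)
    have "x i \<in> ?B" if "i \<le> k" for i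
    proof (cases "i = 0")
      case True
      then show ?thesis using initial by (auto simp: image_iff span_zero)
    next
      case False
      then have "x i \<in> (+) x0 ` span (g ` {..<i})"
        using iterates by (auto simp: is_arg_min_def)
      also have "\<dots> \<subseteq> ?B"
        using that by (intro image_mono span_mono) auto
      finally show ?thesis .
    qed
    then show "?A \<subseteq> ?B"
      using \<open>affine ?B\<close> by (intro hull_minimal) auto
    then have "aff_dim ?A \<le> aff_dim ?B"
      by (rule aff_dim_subset)
    moreover have "aff_dim ?B \<le> int k"
    proof -
      have "dim (g ` {..<k}) \<le> card {..<k}"
        by (meson card_image_le dim_le_card' finite_imageI finite_lessThan le_trans)
      then show ?thesis
        by (simp add: aff_dim_translation_eq aff_dim_subspace)
    qed
    moreover have "int k \<le> aff_dim ?A"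
    proof -
      have "int k = aff_dim (g ` {..k})"
        using aff_dim_orthogonal_family[of "{..k}" g] ne orth by simp
      also have "g ` {..k} = quad_grad H c ` x ` {..k}"
        by (simp add: g_eq image_comp)
      also have "aff_dim \<dots> \<le> aff_dim (x ` {..k})"
        by (rule aff_dim_quad_grad_image_le)
      finally show ?thesis by simp
    qed
    ultimately show "aff_dim ?A = aff_dim ?B" by simp
  qed auto

  have hull_g: "quad_grad H c ` (affine hull (x ` {..k})) = affine hull (g ` {..k})"
    by (simp add: quad_grad_affine_hull g_eq image_comp)

  have "cg_direction g k = - (g k \<bullet> g k) *\<^sub>R u"
    unfolding u_def w_def using ne by (rule cg_direction_closed_form)
  also have "u = (1 / (h \<bullet> h)) *\<^sub>R h"
    using s_pos by (simp add: hh) (simp add: h_def)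
  finally have cg: "cg_direction g k = - ((g k \<bullet> g k) / (h \<bullet> h)) *\<^sub>R h"
    by simp

  have "h \<noteq> 0"
    using hh s_pos by auto
  moreover have "h = (1 / (\<Sum>j\<le>k. 1 / (g j \<bullet> g j))) *\<^sub>R (\<Sum>i\<le>k. (1 / (g i \<bullet> g i)) *\<^sub>R g i)"
    unfolding h_def u_def w_def ..
  ultimately show ?thesis
    unfolding ghat_h hull_g using minh hull_x cg by blast
qed

end
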